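(* The set $\mathscr{D}^\ell=\{\delta^\ell(n): n\in\mathbb{N}\}$ is a well-ordered subset of $\mathbb{R}$ (under the usual order), of order type $\omega^\omega$.
   Context: An addition chain for a positive integer $n$ is a sequence $(a_0,a_1,\ldots,a_r)$ with $a_0=1$, $a_r=n$, and such that for every $1\le k\le r$ there exist $0\le i,j<k$ with $a_k=a_i+a_j$; $r$ is the length of the chain. $\ell(n)$ denotes the least length of an addition chain for $n$. The addition chain defect is $\delta^\ell(n)=\ell(n)-\log_2 n$. Here $\mathbb{N}$ denotes the positive integers. *)

theory Defs
  imports Complex_Main
begin

text \<open>Only the values of the sequence at the indices \<open>0, \<dots>, r\<close> matter.\<close>

definition addition_chain :: "(nat \<Rightarrow> nat) \<Rightarrow> nat \<Rightarrow> nat \<Rightarrow> bool" where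
  "addition_chain a r n \<longleftrightarrow>
     a 0 = 1 \<and> a r = n \<and> (\<forall>k. 1 \<le> k \<and> k \<le> r \<longrightarrow> (\<exists>i<k. \<exists>j<k. a k = a i + a j))"

definition chain_length :: "nat \<Rightarrow> nat" where
  "chain_length n = (LEAST r. \<exists>a. addition_chain a r n)"

definition defect :: "nat \<Rightarrow> real" where
  "defect n = real (chain_length n) - log 2 (real n)"

definition defect_set :: "real set" where
  "defect_set = {defect n | n. 1 \<le> n}"

text \<open>
  The ordinal \<open>\<omega>\<close> to the power \<open>\<omega>\<close>, as a reflexive well-order relation: its elements are the
  finitely supported functions on the naturals, \<open>f\<close> standing for the Cantor normal form
  in which \<open>f i\<close> is the coefficient of the \<open>i\<close>-th power of \<open>\<omega>\<close>. They are compared at the largest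
  argument where they differ. This is the usual set-theoretic definition of the ordinal
  power, with base and exponent both equal to the natural numbers.
\<close>

definition omega_pow_omega :: "(nat \<Rightarrow> nat) rel" where
  "omega_pow_omega =
     {(f, g). finite {i. f i \<noteq> 0} \<and> finite {i. g i \<noteq> 0} \<and>
        (f = g \<or> (\<exists>m. f m < g m \<and> (\<forall>i>m. f i = g i)))}"

lemma addition_chain_exists:
  assumes "1 \<le> n"
  shows "\<exists>r a. addition_chain a r n"
proof -
  have "\<exists>i<k. \<exists>j<k. k + 1 = (i + 1) + (j + 1)" if "1 \<le> k" for k :: nat
    using that by (intro exI[of _ "k - 1"] conjI exI[of _ 0]) auto
  then have "addition_chain (\<lambda>k. k + 1) (n - 1) n"
    using assms by (auto simp: addition_chain_def)
  then show ?thesis by blast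
qed

lemma Field_omega_pow_omega: "Field omega_pow_omega = {f. finite {i. f i \<noteq> 0}}"
  by (auto simp: Field_def omega_pow_omega_def)

lemma wf_omega_pow_omega: "wf (omega_pow_omega - Id)"
proof -
  define R :: "nat \<Rightarrow> (nat \<Rightarrow> nat) rel" where
    "R n = {(f, g). (\<forall>i\<ge>n. f i = 0 \<and> g i = 0) \<and> (\<exists>m. f m < g m \<and> (\<forall>i>m. f i = g i))}" for n
  have wfR: "wf (R n)" for n
  proof (induction n)
    case 0
    have "R 0 = {}" by (auto simp: R_def)
    then show ?case by simp
  next
    case (Suc n)
    have "R (Suc n) \<subseteq> inv_image (less_than <*lex*> R n) (\<lambda>f. (f n, f(n := 0)))"
    proof safe
      fix f g assume "(f, g) \<in> R (Suc n)"
      then obtain m where z: "\<forall>i\<ge>Suc n. f i = 0 \<and> g i = 0"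
        and m: "f m < g m" "\<forall>i>m. f i = g i" by (auto simp: R_def)
      have "m \<le> n" using z m(1) by (metis not_less_eq_eq not_less_zero)
      show "(f, g) \<in> inv_image (less_than <*lex*> R n) (\<lambda>f. (f n, f(n := 0)))"
      proof (cases "m = n")
        case True
        then show ?thesis using m by simp
      next
        case False
        have "(f(n := 0), g(n := 0)) \<in> R n"
          unfolding R_def using z m False by (auto simp: Suc_le_eq intro!: exI[of _ m])
        then show ?thesis using m False \<open>m \<le> n\<close> by simp
      qed
    qed
    then show ?case by (rule wf_subset[rotated]) (auto intro: Suc.IH)
  qed
  show ?thesis
  proof (rule wfI_min)
    fix f :: "nat \<Rightarrow> nat" and Q assume f: "f \<in> Q"
    show "\<exists>g\<in>Q. \<forall>h. (h, g) \<in> omega_pow_omega - Id \<longrightarrow> h \<notin> Q"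
    proof (cases "finite {i. f i \<noteq> 0}")
      case False
      then show ?thesis using f by (auto simp: omega_pow_omega_def)
    next
      case True
      then obtain n where "\<forall>i\<in>{i. f i \<noteq> 0}. i < n"
        using finite_nat_set_iff_bounded by blast
      then have "f \<in> Q \<inter> {g. \<forall>i\<ge>n. g i = 0}" using f by fastforce
      from wfE_min[OF wfR[of n] this]
      obtain g where "g \<in> Q \<inter> {g. \<forall>i\<ge>n. g i = 0}"
        and min: "\<And>h. (h, g) \<in> R n \<Longrightarrow> h \<notin> Q \<inter> {g. \<forall>i\<ge>n. g i = 0}"
        by blast
      then have g: "g \<in> Q" "\<forall>i\<ge>n. g i = 0" by auto
      have "h \<notin> Q" if h: "(h, g) \<in> omega_pow_omega - Id" for h
      proof -
        obtain m where m: "h m < g m" "\<forall>i>m. h i = g i"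
          using h by (auto simp: omega_pow_omega_def)
        then have "m < n" using g(2) by (metis not_le not_less_zero)
        then have "\<forall>i\<ge>n. h i = 0" using m(2) g(2) by auto
        then show ?thesis using min[of h] g(2) m by (auto simp: R_def)
      qed
      then show ?thesis using g(1) by blast
    qed
  qed
qed

lemma Well_order_omega_pow_omega: "Well_order omega_pow_omega"
proof -
  have "trans omega_pow_omega"
  proof (rule transI)
    fix f g h assume fg: "(f, g) \<in> omega_pow_omega" and gh: "(g, h) \<in> omega_pow_omega"
    show "(f, h) \<in> omega_pow_omega"
    proof (cases "f = g \<or> g = h")
      case True
      then show ?thesis using fg gh by auto
    next
      case False
      then obtain m k where "f m < g m" "\<forall>i>m. f i = g i" "g k < h k" "\<forall>i>k. g i = h i"
        using fg gh by (auto simp: omega_pow_omega_def)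
      then have "f (max m k) < h (max m k) \<and> (\<forall>i>max m k. f i = h i)"
        by (cases m k rule: linorder_cases) (auto simp: max_def)
      then show ?thesis using fg gh by (auto simp: omega_pow_omega_def)
    qed
  qed
  moreover have "antisym omega_pow_omega"
    using wf_omega_pow_omega unfolding antisym_def
    by (metis DiffI pair_in_Id_conv wf_not_sym)
  moreover have "total_on (Field omega_pow_omega) omega_pow_omega"
    unfolding total_on_def Field_omega_pow_omega
  proof (intro ballI impI)
    fix f g :: "nat \<Rightarrow> nat"
    assume f: "f \<in> {f. finite {i. f i \<noteq> 0}}" and g: "g \<in> {f. finite {i. f i \<noteq> 0}}"
      and "f \<noteq> g"
    let ?D = "{i. f i \<noteq> g i}"
    have "?D \<subseteq> {i. f i \<noteq> 0} \<union> {i. g i \<noteq> 0}" by auto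
    then have fin: "finite ?D" using f g finite_subset by auto
    have ne: "?D \<noteq> {}" using \<open>f \<noteq> g\<close> by auto
    have "f (Max ?D) \<noteq> g (Max ?D)" using Max_in[OF fin ne] by simp
    moreover have "\<forall>i>Max ?D. f i = g i" using Max_ge[OF fin] by (metis (mono_tags, lifting) mem_Collect_eq not_le)
    ultimately obtain m where "f m < g m \<or> g m < f m" "\<forall>i>m. f i = g i"
      using linorder_neqE_nat by blast
    then have "(\<exists>m. f m < g m \<and> (\<forall>i>m. f i = g i)) \<or> (\<exists>m. g m < f m \<and> (\<forall>i>m. g i = f i))"
      by auto
    then show "(f, g) \<in> omega_pow_omega \<or> (g, f) \<in> omega_pow_omega"
      using f g unfolding omega_pow_omega_def by blast
  qed
  moreover have "refl_on (Field omega_pow_omega) omega_pow_omega"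
    unfolding refl_on_def Field_omega_pow_omega by (auto simp: omega_pow_omega_def)
  moreover have "omega_pow_omega \<subseteq> Field omega_pow_omega \<times> Field omega_pow_omega"
    by (auto simp: Field_def)
  ultimately show ?thesis
    using wf_omega_pow_omega
    by (simp add: well_order_on_def linear_order_on_def partial_order_on_def preorder_on_def)
qed

end

theory Submission
  imports Defs "HOL-Library.Infinite_Set"
begin

text \<open>
  Write \<open>n = 2 ^ K * (1 + x)\<close> with \<open>0 \<le> x < 1\<close> and \<open>s = \<ell>(n) - K\<close>, so that the defect is
  \<open>s - log\<^sub>2 (1 + x)\<close>. A step of a chain that is not a doubling multiplies the attainable maximum
  by at most \<open>5/3\<close>, so an optimal chain has at most \<open>4 * s\<close> such steps and \<open>n\<close> has at most
  \<open>16 ^ s\<close> binary ones. For fixed \<open>s\<close>, the mantissas \<open>x\<close> with boundedly many ones are reversely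
  well-ordered, by comparing the gaps between consecutive ones lexicographically; this maps the
  defects strictly monotonically into \<open>\<omega>\<close> to the power \<open>\<omega>\<close>.

  Conversely, the numbers with exactly \<open>k + 1\<close> binary ones satisfy \<open>s \<le> k\<close> and have mantissas of
  (reverse) order type \<open>\<omega> ^ k\<close>. The value of \<open>s\<close> colours \<open>\<omega> ^ k\<close> with finitely many colours, and
  some colour class still has type \<open>\<omega> ^ k\<close>; on it the defect is strictly monotone. Hence the
  defects have order type at least \<open>\<omega> ^ k\<close> for every \<open>k\<close>.
\<close>

section \<open>Sums of powers of two and the growth of addition chains\<close>

text \<open>The exponents form a set and are therefore distinct, so this bounds the number of binary
  ones of \<open>n\<close> by \<open>m\<close>.\<close>

definition sum_of_powers :: "nat \<Rightarrow> nat \<Rightarrow> bool" where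
  "sum_of_powers m n \<longleftrightarrow> (\<exists>A. finite A \<and> card A \<le> m \<and> n = (\<Sum>i\<in>A. 2 ^ i))"

text \<open>Carrying: if \<open>e\<close> is taken, the two copies of \<open>2 ^ e\<close> merge
  into \<open>2 ^ Suc e\<close>, which is left to be added to the smaller set.\<close>

lemma add_power_to_sum_of_powers:
  assumes "finite A"
  shows "\<exists>B. finite B \<and> card B \<le> Suc (card A) \<and> (\<Sum>i\<in>A. 2 ^ i) + 2 ^ e = (\<Sum>i\<in>B. 2 ^ i :: nat)"
  using assms
proof (induction "card A" arbitrary: A e rule: less_induct)
  case less
  show ?case
  proof (cases "e \<in> A")
    case False
    then show ?thesis
      using less.prems by (intro exI[of _ "insert e A"]) auto
  next
    case True
    then have "card (A - {e}) < card A"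
      using less.prems by (meson card_Diff1_less)
    from less.hyps[OF this, of "Suc e"] less.prems obtain B where
      B: "finite B" "card B \<le> Suc (card (A - {e}))"
        "(\<Sum>i\<in>A - {e}. 2 ^ i) + 2 ^ Suc e = (\<Sum>i\<in>B. 2 ^ i :: nat)"
      by auto
    have "(\<Sum>i\<in>A. 2 ^ i) + 2 ^ e = (\<Sum>i\<in>A - {e}. 2 ^ i) + (2 ^ Suc e :: nat)"
      using less.prems True by (simp add: sum.remove)
    then show ?thesis
      using B \<open>card (A - {e}) < card A\<close> by (intro exI[of _ B]) auto
  qed
qed

lemma sum_of_powers_mono:
  assumes "sum_of_powers m x" "m \<le> k"
  shows "sum_of_powers k x"
proof -
  obtain A where "finite A" "card A \<le> m" "x = (\<Sum>i\<in>A. 2 ^ i)"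
    using assms(1) by (auto simp: sum_of_powers_def)
  then show ?thesis
    unfolding sum_of_powers_def using assms(2) by (intro exI[of _ A] conjI) auto
qed

lemma sum_of_powers_add:
  assumes "sum_of_powers m x" "sum_of_powers k y"
  shows "sum_of_powers (m + k) (x + y)"
proof -
  obtain A where A: "finite A" "card A \<le> m" "x = (\<Sum>i\<in>A. 2 ^ i)"
    using assms(1) by (auto simp: sum_of_powers_def)
  have "sum_of_powers (m + card C) (x + (\<Sum>i\<in>C. 2 ^ i))" if "finite C" for C
    using that
  proof (induction C)
    case empty
    then show ?case using assms(1) by simp
  next
    case (insert e C)
    then obtain B where B: "finite B" "card B \<le> m + card C"
      "x + (\<Sum>i\<in>C. 2 ^ i) = (\<Sum>i\<in>B. 2 ^ i)"
      by (auto simp: sum_of_powers_def)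
    from add_power_to_sum_of_powers[OF B(1), of e] obtain B' where
      B': "finite B'" "card B' \<le> Suc (card B)"
        "(\<Sum>i\<in>B. 2 ^ i) + 2 ^ e = (\<Sum>i\<in>B'. 2 ^ i :: nat)"
      by auto
    have "x + (\<Sum>i\<in>insert e C. 2 ^ i) = (\<Sum>i\<in>B'. 2 ^ i)"
      using insert.hyps B(3) B'(3) by simp
    moreover have "card B' \<le> m + card (insert e C)" using insert.hyps B(2) B'(2) by simp
    ultimately show ?case
      using B'(1) unfolding sum_of_powers_def by blast
  qed
  moreover obtain C where C: "finite C" "card C \<le> k" "y = (\<Sum>i\<in>C. 2 ^ i)"
    using assms(2) by (auto simp: sum_of_powers_def)
  ultimately have "sum_of_powers (m + card C) (x + y)" by blast
  then show ?thesis by (rule sum_of_powers_mono) (use C in simp)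
qed

section \<open>Nondoubling steps of addition chains\<close>

definition nondoublings :: "(nat \<Rightarrow> nat) \<Rightarrow> nat \<Rightarrow> nat" where
  "nondoublings a k = (\<Sum>j=1..k. if \<exists>i<j. a j = 2 * a i then 0 else 1)"

lemma nondoublings_Suc:
  "nondoublings a (Suc k) = nondoublings a k + (if \<exists>i<Suc k. a (Suc k) = 2 * a i then 0 else 1)"
  by (simp add: nondoublings_def)

lemma addition_chain_SucE:
  assumes "addition_chain a r n" "Suc k \<le> r"
  obtains (doubling) i where "i \<le> k" "a (Suc k) = 2 * a i"
      "nondoublings a (Suc k) = nondoublings a k"
    | (nondoubling) i j where "i < j" "j \<le> k" "a (Suc k) = a i + a j"
      "nondoublings a (Suc k) = Suc (nondoublings a k)"
proof (cases "\<exists>i<Suc k. a (Suc k) = 2 * a i")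
  case True
  then obtain i where "i < Suc k" "a (Suc k) = 2 * a i" by blast
  moreover have "nondoublings a (Suc k) = nondoublings a k"
    using True by (simp only: nondoublings_Suc if_True add_0_right)
  ultimately show ?thesis using doubling less_Suc_eq_le by blast
next
  case False
  obtain i j where ij: "i < Suc k" "j < Suc k" "a (Suc k) = a i + a j"
    using assms unfolding addition_chain_def by (metis One_nat_def Suc_le_mono le0)
  then have "i \<noteq> j" using False by auto
  moreover have "nondoublings a (Suc k) = Suc (nondoublings a k)"
    using False by (simp add: nondoublings_Suc)
  ultimately show ?thesis
    using ij nondoubling[of i j] nondoubling[of j i]
    by (cases i j rule: linorder_cases) (auto simp: less_Suc_eq_le)
qed

lemma addition_chain_last: "addition_chain a r n \<Longrightarrow> a r = n"
  by (simp add: addition_chain_def)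

text \<open>A doubling shifts the exponents; any other step adds two earlier terms, which at most
  doubles the bound. The induction covers all \<open>i \<le> k\<close> since a step may use any
  earlier terms.\<close>

lemma addition_chain_sum_of_powers:
  assumes "addition_chain a r n" "i \<le> k" "k \<le> r"
  shows "sum_of_powers (2 ^ nondoublings a k) (a i)"
  using assms(2,3)
proof (induction k arbitrary: i)
  case 0
  then have "a i = (\<Sum>i\<in>{0}. 2 ^ i)" using assms(1) by (simp add: addition_chain_def)
  then show ?case
    unfolding sum_of_powers_def by (intro exI[of _ "{0}"]) (auto simp: nondoublings_def)
next
  case (Suc k)
  show ?case
  proof (cases "i = Suc k")
    case False
    then have "sum_of_powers (2 ^ nondoublings a k) (a i)" using Suc by auto
    then show ?thesis
      by (rule sum_of_powers_mono) (simp add: nondoublings_Suc)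
  next
    case True
    show ?thesis
      using assms(1) \<open>Suc k \<le> r\<close>
    proof (cases rule: addition_chain_SucE)
      case (doubling j)
      have "sum_of_powers (2 ^ nondoublings a k) (a j)"
        using doubling(1) Suc.prems(2) by (intro Suc.IH) auto
      then obtain A where A: "finite A" "card A \<le> 2 ^ nondoublings a k" "a j = (\<Sum>i\<in>A. 2 ^ i)"
        unfolding sum_of_powers_def by blast
      have "2 * a j = (\<Sum>i\<in>Suc ` A. 2 ^ i)"
        unfolding A(3) sum_distrib_left by (subst sum.reindex) auto
      then have "a i = (\<Sum>i\<in>Suc ` A. 2 ^ i)" using doubling(2) True by simp
      moreover have "card (Suc ` A) \<le> 2 ^ nondoublings a (Suc k)"
        using A(2) doubling(3) by (simp add: card_image)
      ultimately show ?thesis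
        using A(1) unfolding sum_of_powers_def by blast
    next
      case (nondoubling p q)
      then have "sum_of_powers (2 ^ nondoublings a k) (a p)" "sum_of_powers (2 ^ nondoublings a k) (a q)"
        using Suc.prems(2) by (auto intro: Suc.IH)
      from sum_of_powers_add[OF this] show ?thesis
        unfolding True nondoubling(3,4) power_Suc mult_2 .
    qed
  qed
qed

text \<open>
  The two summands of a nondoubling step have distinct indices, so with \<open>b k\<close> the bound at step
  \<open>k\<close> the term at step \<open>k + 1\<close> is at most \<open>b k + b (k - 1) \<le> (1 + 3/5) * b k\<close>: a nondoubling multiplies
  the bound by \<open>5/3\<close> only.
\<close>

lemma addition_chain_growth:
  assumes "addition_chain a r n" "i \<le> k" "k \<le> r"
  shows "real (a i) \<le> 2 ^ k * (5/6) ^ nondoublings a k"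
  using assms(2,3)
proof (induction k arbitrary: i rule: less_induct)
  case (less k)
  define b :: "nat \<Rightarrow> real" where "b j = 2 ^ j * (5/6) ^ nondoublings a j" for j
  have b0: "b j \<ge> 0" for j by (simp add: b_def)
  have IH: "real (a i) \<le> b j" if "j < k" "i \<le> j" for i j
    using less that unfolding b_def by auto
  have bS: "5/3 * b j \<le> b (Suc j)" for j
    using b0[of j] by (simp add: b_def nondoublings_Suc)
  show ?case
  proof (cases k)
    case 0
    then show ?thesis using assms(1) less.prems by (simp add: addition_chain_def nondoublings_def)
  next
    case (Suc l)
    have "real (a i) \<le> b k"
    proof (cases "i = k")
      case False
      then have "real (a i) \<le> b l" using IH less.prems Suc by auto
      then show ?thesis using bS[of l] b0[of l] Suc by auto
    next
      case True
      have "Suc l \<le> r" using less.prems Suc by auto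
      with assms(1) show ?thesis
      proof (cases rule: addition_chain_SucE)
        case (doubling j)
        then show ?thesis using IH[of l j] Suc True by (simp add: b_def)
      next
        case (nondoubling p q)
        \<comment> \<open>\<open>p < q\<close> and \<open>q \<le> l\<close> make \<open>l\<close>
          positive and put \<open>p\<close> at index \<open>l'\<close> or below; then
          \<open>b l' + b l\<close> is at most \<open>8/5 * b l\<close>.\<close>
        then obtain l' where l': "l = Suc l'" by (cases l) auto
        have "real (a p) \<le> b l'" "real (a q) \<le> b l"
          using IH nondoubling Suc l' by auto
        moreover have "b k = 5/3 * b l" using nondoubling Suc by (simp add: b_def)
        ultimately show ?thesis
          using bS[of l'] b0[of l'] b0[of l] nondoubling Suc True l' by simp
      qed
    qed
    then show ?thesis by (simp add: b_def)
  qed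
qed

lemma optimal_chain: "1 \<le> n \<Longrightarrow> \<exists>a. addition_chain a (chain_length n) n"
  unfolding chain_length_def by (rule LeastI_ex) (rule addition_chain_exists)

lemma chain_length_le: "addition_chain a r n \<Longrightarrow> chain_length n \<le> r"
  unfolding chain_length_def by (rule Least_le) blast

lemma le_two_power_chain_length:
  assumes "1 \<le> n"
  shows "real n \<le> 2 ^ chain_length n"
proof -
  obtain a where a: "addition_chain a (chain_length n) n" using optimal_chain[OF assms] by blast
  have "real n \<le> 2 ^ chain_length n * (5/6) ^ nondoublings a (chain_length n)"
    using addition_chain_growth[OF a order.refl order.refl] unfolding addition_chain_last[OF a] .
  also have "\<dots> \<le> 2 ^ chain_length n * 1"
    by (intro mult_left_mono power_le_one) auto
  finally show ?thesis by simp
qed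

section \<open>Mantissas with boundedly many binary digits\<close>

text \<open>\<open>x\<close> is a binary fraction with at most \<open>m\<close> ones:
  \<open>b\<close> is the position of its first one, and \<open>y\<close> is the fraction formed by
  the digits after it.\<close>

inductive mantissa :: "nat \<Rightarrow> real \<Rightarrow> bool" where
  zero: "mantissa m 0"
| shift: "mantissa m y \<Longrightarrow> 1 \<le> b \<Longrightarrow> mantissa (Suc m) ((1 + y) / 2 ^ b)"

lemma mantissa_bounds: "mantissa m x \<Longrightarrow> 0 \<le> x \<and> x < 1"
proof (induction rule: mantissa.induct)
  case (shift m y b)
  have "(2::real) ^ 1 \<le> 2 ^ b" using shift by (intro power_increasing) auto
  then show ?case using shift by (auto simp: field_simps)
qed simp

lemma mantissa_mono: "mantissa m x \<Longrightarrow> m \<le> k \<Longrightarrow> mantissa k x"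
proof (induction arbitrary: k rule: mantissa.induct)
  case (shift m y b)
  then show ?case by (cases k) (auto intro: mantissa.intros)
qed (rule mantissa.zero)

text \<open>Remove the largest exponent; its distance to the next one is the first shift.\<close>

lemma sum_powers_mantissa:
  assumes "finite A" "A \<noteq> {}" "card A \<le> Suc m"
  shows "\<exists>x. mantissa m x \<and> real (\<Sum>i\<in>A. 2 ^ i) = 2 ^ Max A * (1 + x)"
  using assms
proof (induction m arbitrary: A)
  case 0
  then have "card A = 1" by (simp add: card_gt_0_iff le_antisym Suc_le_eq)
  then obtain e where "A = {e}" by (auto simp: card_1_singleton_iff)
  then show ?case using mantissa.zero[of 0] by (intro exI[of _ 0]) auto
next
  case (Suc m)
  define B where "B = A - {Max A}"
  have Max: "Max A \<in> A" using Suc by auto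
  then have sumA: "(\<Sum>i\<in>A. 2 ^ i) = 2 ^ Max A + (\<Sum>i\<in>B. 2 ^ i :: nat)"
    using Suc by (simp add: sum.remove B_def)
  show ?case
  proof (cases "B = {}")
    case True
    then show ?thesis
      using sumA mantissa.zero[of "Suc m"] by (intro exI[of _ 0]) auto
  next
    case False
    have "finite B" "card B \<le> Suc m" using Suc Max by (auto simp: B_def)
    then obtain y where y: "mantissa m y" "real (\<Sum>i\<in>B. 2 ^ i) = 2 ^ Max B * (1 + y)"
      using Suc.IH False by blast
    have "Max B \<in> B" using \<open>finite B\<close> False by auto
    then have "Max B < Max A" using Suc.prems by (auto simp: B_def less_le)
    define d where "d = Max A - Max B"
    have d: "Max A = Max B + d" "1 \<le> d" using \<open>Max B < Max A\<close> by (auto simp: d_def)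
    have "real (\<Sum>i\<in>A. 2 ^ i) = 2 ^ Max A + 2 ^ Max B * (1 + y)"
      unfolding sumA of_nat_add y(2) by simp
    also have "\<dots> = 2 ^ Max A * (1 + (1 + y) / 2 ^ d)"
      by (simp add: d power_add field_simps)
    finally show ?thesis using mantissa.shift[OF y(1) d(2)] by blast
  qed
qed

text \<open>From \<open>2 ^ K \<le> n\<close> and \<open>n \<le> 2 ^ (K + s) * (5/6) ^ f\<close>
  follows \<open>(6/5) ^ f \<le> 2 ^ s\<close>, which bounds the number \<open>f\<close> of
  nondoublings, and with it the number of binary ones, in terms of \<open>s\<close> alone.\<close>

lemma chain_length_mantissa:
  assumes "1 \<le> n"
  obtains K s x where "real n = 2 ^ K * (1 + x)" "chain_length n = K + s" "mantissa (16 ^ s) x"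
proof -
  obtain a where a: "addition_chain a (chain_length n) n" using optimal_chain[OF assms] by blast
  define f where "f = nondoublings a (chain_length n)"
  have "sum_of_powers (2 ^ f) n"
    using addition_chain_sum_of_powers[OF a order.refl order.refl]
    unfolding addition_chain_last[OF a] f_def .
  then obtain A where A: "finite A" "card A \<le> 2 ^ f" "n = (\<Sum>i\<in>A. 2 ^ i)"
    by (auto simp: sum_of_powers_def)
  moreover have "A \<noteq> {}" using A assms by auto
  ultimately obtain x where x: "mantissa (2 ^ f) x" "real n = 2 ^ Max A * (1 + x)"
    using sum_powers_mantissa[of A "2 ^ f"] by auto
  define K where "K = Max A"
  have Kn: "2 ^ K \<le> real n"
    using x mantissa_bounds[OF x(1)] by (simp add: K_def)
  then have "(2::real) ^ K \<le> 2 ^ chain_length n"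
    using le_two_power_chain_length[OF assms] by linarith
  then obtain s where s: "chain_length n = K + s"
    using power_le_imp_le_exp[of 2 K "chain_length n"] le_Suc_ex by auto
  have "real n \<le> 2 ^ (K + s) * (5/6) ^ f"
    using addition_chain_growth[OF a order.refl order.refl]
    unfolding addition_chain_last[OF a] unfolding f_def s .
  with Kn have "2 ^ K \<le> 2 ^ (K + s) * ((5/6) ^ f :: real)" by (rule order_trans)
  then have "2 ^ K * 1 \<le> 2 ^ K * (2 ^ s * (5/6) ^ f :: real)"
    unfolding power_add mult.assoc mult_1_right .
  then have "1 \<le> (2 ^ s * (5/6) ^ f :: real)"
    by (rule mult_left_le_imp_le) simp
  then have "(6/5) ^ f * 1 \<le> (6/5) ^ f * (2 ^ s * (5/6) ^ f :: real)"
    by (rule mult_left_mono) simp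
  also have "\<dots> = 2 ^ s * (6/5 * (5/6)) ^ f" unfolding power_mult_distrib by (rule mult.left_commute)
  finally have le: "(6/5) ^ f \<le> (2 ^ s :: real)" by simp
  \<comment> \<open>The factor 4 works because \<open>(6/5) ^ 4 = 1296/625\<close> exceeds 2; it
    leads to \<open>2 ^ f \<le> 16 ^ s\<close>.\<close>
  have "f \<le> 4 * s"
  proof (rule ccontr)
    assume "\<not> f \<le> 4 * s"
    then have "(6/5) ^ f > ((6/5) ^ (4 * s) :: real)" by (intro power_strict_increasing) auto
    moreover have "(6/5) ^ (4 * s) \<ge> (2 ^ s :: real)"
      unfolding power_mult by (intro power_mono) (auto simp: power_divide)
    ultimately show False using le by linarith
  qed
  then have "(2::nat) ^ f \<le> 2 ^ (4 * s)" by (intro power_increasing) auto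
  then have "mantissa (16 ^ s) x" by (intro mantissa_mono[OF x(1)]) (simp add: power_mult)
  then show ?thesis using that x(2) s by (simp add: K_def)
qed

lemma defect_eq:
  assumes "real n = 2 ^ K * (1 + x)" "chain_length n = K + s" "0 \<le> x"
  shows "defect n = real s - log 2 (1 + x)"
  using assms by (simp add: defect_def log_mult log_nat_power)

section \<open>An order embedding of the defects into finitely supported functions\<close>

definition lex_less :: "(nat \<Rightarrow> nat) \<Rightarrow> (nat \<Rightarrow> nat) \<Rightarrow> bool" where
  "lex_less f g \<longleftrightarrow> (\<exists>m. f m < g m \<and> (\<forall>i>m. f i = g i))"

text \<open>The functions below the ordinal \<open>\<omega> ^ k\<close>, an initial segment of
  \<open>omega_pow_omega\<close>.\<close>

definition supported_below :: "nat \<Rightarrow> (nat \<Rightarrow> nat) set" where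
  "supported_below k = {f. \<forall>i\<ge>k. f i = 0}"

lemma finite_support_iff: "finite {i. f i \<noteq> 0} \<longleftrightarrow> (\<exists>k. f \<in> supported_below k)"
  for f :: "nat \<Rightarrow> nat"
proof
  assume "finite {i. f i \<noteq> 0}"
  then obtain k where "\<forall>i\<in>{i. f i \<noteq> 0}. i < k" using finite_nat_set_iff_bounded by blast
  then have "f i = 0" if "k \<le> i" for i using that by fastforce
  then show "\<exists>k. f \<in> supported_below k" unfolding supported_below_def by blast
next
  assume "\<exists>k. f \<in> supported_below k"
  then obtain k where k: "f \<in> supported_below k" by blast
  have "{i. f i \<noteq> 0} \<subseteq> {..<k}"
  proof (intro subsetI, rule ccontr)
    fix i assume "i \<in> {i. f i \<noteq> 0}" "i \<notin> {..<k}"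
    then show False using k by (simp add: supported_below_def)
  qed
  then show "finite {i. f i \<noteq> 0}" using finite_subset by blast
qed

lemma strict_omega_pow_omega_iff:
  "(f, g) \<in> omega_pow_omega - Id \<longleftrightarrow>
     f \<in> Field omega_pow_omega \<and> g \<in> Field omega_pow_omega \<and> lex_less f g"
proof -
  have "\<not> lex_less f f" by (simp add: lex_less_def)
  then show ?thesis
    unfolding Field_omega_pow_omega
    unfolding omega_pow_omega_def lex_less_def[symmetric] by blast
qed

lemma supported_below_Field: "f \<in> supported_below k \<Longrightarrow> f \<in> Field omega_pow_omega"
  unfolding Field_omega_pow_omega mem_Collect_eq finite_support_iff by blast

lemma supported_below_less:
  assumes "g \<in> supported_below k" "n < g m"
  shows "m < k"
proof (rule ccontr)
  assume "\<not> m < k"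
  then have "g m = 0" using assms(1) by (simp add: supported_below_def)
  then show False using assms(2) by simp
qed

text \<open>The deciding coordinate has a positive value in \<open>g\<close>, so it lies below
  \<open>k\<close>; beyond it \<open>f\<close> and \<open>g\<close> agree.\<close>

lemma supported_below_lex_less:
  "lex_less f g \<Longrightarrow> f \<in> Field omega_pow_omega \<Longrightarrow> g \<in> supported_below k \<Longrightarrow> f \<in> supported_below k"
  unfolding lex_less_def supported_below_def
  by clarsimp (metis gr_implies_not0 le_less_trans linorder_not_le)

text \<open>
  Larger mantissas get smaller codes. Each binary digit uses two coordinates: the lower one holds
  the gap \<open>b\<close> to the next digit, and the upper one flags that there are no more digits, which
  acts as an infinite gap.
\<close>

fun mantissa_code :: "nat \<Rightarrow> real \<Rightarrow> nat \<Rightarrow> nat" where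
  "mantissa_code 0 x = (\<lambda>i. 0)"
| "mantissa_code (Suc m) x =
     (if x = 0 then (\<lambda>i. 0)(2 * m + 2 := 1)
      else let b = nat \<lceil>- log 2 x\<rceil> in (mantissa_code m (2 ^ b * x - 1))(2 * m + 1 := b))"

lemma mantissa_code_supported: "mantissa_code m x \<in> supported_below (2 * m + 1)"
  by (induction m arbitrary: x) (auto simp: supported_below_def Let_def)

text \<open>Since \<open>1 \<le> 1 + y < 2\<close>, the negated logarithm is above
  \<open>b - 1\<close> and at most \<open>b\<close>, so its ceiling recovers the gap
  \<open>b\<close>.\<close>

lemma mantissa_code_shift:
  assumes "mantissa m y"
  shows "mantissa_code (Suc m) ((1 + y) / 2 ^ b) = (mantissa_code m y)(2 * m + 1 := b)"
proof -
  have y: "0 \<le> y" "y < 1" using mantissa_bounds[OF assms] by auto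
  have "- log 2 ((1 + y) / 2 ^ b) = real b - log 2 (1 + y)"
    using y by (simp add: log_divide log_nat_power)
  moreover have "0 \<le> log 2 (1 + y)" "log 2 (1 + y) < 1" using y by auto
  ultimately have "\<lceil>- log 2 ((1 + y) / 2 ^ b)\<rceil> = int b"
    by (intro ceiling_unique) auto
  then show ?thesis using y by (simp add: Let_def)
qed

text \<open>The top coordinates decide: having no further digit gives the smallest mantissa,
  otherwise the larger first gap does, and equal gaps pass the comparison on to the remaining
  digits.\<close>

lemma mantissa_code_less:
  assumes "mantissa m x" "mantissa m x'" "x' < x"
  shows "lex_less (mantissa_code m x) (mantissa_code m x')"
  using assms
proof (induction m arbitrary: x x')
  case 0
  then show ?case by (auto elim: mantissa.cases)
next
  case (Suc m)
  have "x \<noteq> 0" using Suc.prems mantissa_bounds[of "Suc m" x'] by auto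
  with Suc.prems(1) obtain y b where x: "x = (1 + y) / 2 ^ b" "mantissa m y" "1 \<le> b"
    by (auto elim: mantissa.cases)
  have y: "0 \<le> y" "y < 1" using mantissa_bounds[OF x(2)] by auto
  have c: "mantissa_code (Suc m) x = (mantissa_code m y)(2 * m + 1 := b)"
    unfolding x(1) by (rule mantissa_code_shift[OF x(2)])
  have supp: "mantissa_code m z i = 0" if "2 * m + 1 \<le> i" for z i
    using mantissa_code_supported[of m z] that by (auto simp: supported_below_def)
  show ?case
  proof (cases "x' = 0")
    case True
    then show ?thesis
      unfolding c lex_less_def using supp by (intro exI[of _ "2 * m + 2"]) auto
  next
    case False
    with Suc.prems(2) obtain y' b' where x': "x' = (1 + y') / 2 ^ b'" "mantissa m y'" "1 \<le> b'"
      by (auto elim: mantissa.cases)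
    have y': "0 \<le> y'" "y' < 1" using mantissa_bounds[OF x'(2)] by auto
    have c': "mantissa_code (Suc m) x' = (mantissa_code m y')(2 * m + 1 := b')"
      unfolding x'(1) by (rule mantissa_code_shift[OF x'(2)])
    consider "b < b'" | "b = b'" | "b' < b" by linarith
    then show ?thesis
    proof cases
      case 1
      then show ?thesis
        unfolding c c' lex_less_def using supp by (intro exI[of _ "2 * m + 1"]) auto
    next
      case 2
      then have "y' < y" using Suc.prems(3) by (simp add: x(1) x'(1) divide_simps)
      then obtain j where j: "mantissa_code m y j < mantissa_code m y' j"
        "\<forall>i>j. mantissa_code m y i = mantissa_code m y' i"
        using Suc.IH x(2) x'(2) unfolding lex_less_def by blast
      then have "j < 2 * m + 1" using supp[of j y'] by (metis not_less0 not_le)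
      then show ?thesis
        unfolding c c' lex_less_def using j 2 by (intro exI[of _ j]) auto
    next
      case 3
      then have "(2::real) ^ Suc b' \<le> 2 ^ b" by (intro power_increasing) auto
      then have "(1 + y) / 2 ^ b \<le> 2 / 2 ^ Suc b'"
        using y by (intro frac_le) auto
      also have "\<dots> \<le> (1 + y') / 2 ^ b'" using y' by (simp add: divide_simps)
      finally show ?thesis using Suc.prems(3) by (simp add: x(1) x'(1))
    qed
  qed
qed

text \<open>A defect is \<open>s - log 2 (1 + x)\<close> with the logarithm in [0, 1), so
  \<open>s\<close> is its ceiling and \<open>x\<close> is \<open>2 powr (s - d) - 1\<close>. The
  mark at the free coordinate \<open>2 * m + 1\<close> ranks larger \<open>s\<close> above smaller
  \<open>s\<close>.\<close>

definition defect_code :: "real \<Rightarrow> nat \<Rightarrow> nat" where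
  "defect_code d = (let s = nat \<lceil>d\<rceil>; m = 16 ^ s in
     (mantissa_code m (2 powr (real s - d) - 1))(2 * m + 1 := 1))"

lemma defect_set_cases:
  assumes "d \<in> defect_set"
  obtains s x where "mantissa (16 ^ s) x" "d = real s - log 2 (1 + x)" "s = nat \<lceil>d\<rceil>"
    "defect_code d = (mantissa_code (16 ^ s) x)(2 * 16 ^ s + 1 := 1)"
proof -
  obtain n where n: "1 \<le> n" "d = defect n" using assms by (auto simp: defect_set_def)
  obtain K s x where K: "real n = 2 ^ K * (1 + x)" "chain_length n = K + s" "mantissa (16 ^ s) x"
    using chain_length_mantissa[OF n(1)] .
  have x: "0 \<le> x" "x < 1" using mantissa_bounds[OF K(3)] by auto
  have d: "d = real s - log 2 (1 + x)" using defect_eq[OF K(1,2) x(1)] n by simp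
  moreover have "0 \<le> log 2 (1 + x)" "log 2 (1 + x) < 1" using x by auto
  ultimately have "\<lceil>d\<rceil> = int s" by (intro ceiling_unique) auto
  moreover from this have "defect_code d = (mantissa_code (16 ^ s) x)(2 * 16 ^ s + 1 := 1)"
    using d x by (simp add: defect_code_def Let_def)
  ultimately show ?thesis using that K(3) d by simp
qed

lemma defect_code_Field:
  assumes "d \<in> defect_set"
  shows "defect_code d \<in> Field omega_pow_omega"
  using assms
proof (cases rule: defect_set_cases)
  case (1 s x)
  have "(mantissa_code (16 ^ s) x)(2 * 16 ^ s + 1 := 1) \<in> supported_below (2 * 16 ^ s + 2)"
    using mantissa_code_supported[of "16 ^ s" x] by (auto simp: supported_below_def)
  then show ?thesis using 1 supported_below_Field by metis
qed

lemma defect_code_less: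
  assumes "d \<in> defect_set" "d' \<in> defect_set" "d < d'"
  shows "lex_less (defect_code d) (defect_code d')"
  using assms(1)
proof (cases rule: defect_set_cases)
  case d: (1 s x)
  show ?thesis
    using assms(2)
  proof (cases rule: defect_set_cases)
    case d': (1 s' x')
    have supp: "mantissa_code m z i = 0" if "2 * m + 1 \<le> i" for m z i
      using mantissa_code_supported[of m z] that by (auto simp: supported_below_def)
    have "\<lceil>d\<rceil> \<le> \<lceil>d'\<rceil>" using assms(3) by (intro ceiling_mono) simp
    then have "s \<le> s'" unfolding d(3) d'(3) by (rule nat_mono)
    then consider "s = s'" | "s < s'" by linarith
    then show ?thesis
    proof cases
      case 1
      have "0 \<le> x" "0 \<le> x'" using mantissa_bounds d(1) d'(1) by auto
      moreover have "log 2 (1 + x') < log 2 (1 + x)" using assms(3) d(2) d'(2) 1 by simp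
      ultimately have "x' < x" by simp
      then obtain j where j: "mantissa_code (16 ^ s) x j < mantissa_code (16 ^ s) x' j"
        "\<forall>i>j. mantissa_code (16 ^ s) x i = mantissa_code (16 ^ s) x' i"
        using mantissa_code_less d(1) d'(1) 1 unfolding lex_less_def by blast
      then have "j < 2 * 16 ^ s + 1" using supp[of "16 ^ s" j x'] by (metis not_less0 not_le)
      then show ?thesis
        unfolding d(4) d'(4) lex_less_def using j 1 by (intro exI[of _ j]) auto
    next
      case 2
      then have "(16::nat) ^ s < 16 ^ s'" by simp
      then have "mantissa_code (16 ^ s) x i = 0" "mantissa_code (16 ^ s') x' i = 0"
        "i \<noteq> 2 * 16 ^ s + 1" if "2 * 16 ^ s' < i" for i
        using that by ((intro supp)?, linarith)+
      then show ?thesis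
        unfolding d(4) d'(4) lex_less_def
        by (intro exI[of _ "2 * 16 ^ s' + 1"]) auto
    qed
  qed
qed

section \<open>Many defects with few small steps\<close>

text \<open>The gaps are \<open>Suc (f i)\<close>, so every \<open>f\<close> is admissible; the
  first gap comes from the highest index \<open>k - 1\<close>, matching the comparison at the
  largest differing argument.\<close>

fun gap_mantissa :: "nat \<Rightarrow> (nat \<Rightarrow> nat) \<Rightarrow> real" where
  "gap_mantissa 0 f = 0"
| "gap_mantissa (Suc k) f = (1 + gap_mantissa k f) / 2 ^ Suc (f k)"

lemma gap_mantissa_bounds: "0 \<le> gap_mantissa k f" "gap_mantissa k f < 1"
proof -
  have "mantissa k (gap_mantissa k f)"
    by (induction k) (auto intro: mantissa.zero mantissa.shift simp del: power_Suc)
  then show "0 \<le> gap_mantissa k f" "gap_mantissa k f < 1" using mantissa_bounds by auto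
qed

lemma gap_mantissa_antimono:
  assumes "f m < g m" "\<forall>i>m. f i = g i" "m < k"
  shows "gap_mantissa k g < gap_mantissa k f"
  using assms(3)
proof (induction k)
  case (Suc k)
  show ?case
  proof (cases "m = k")
    case False
    then show ?thesis using Suc assms by (simp add: divide_simps)
  next
    case True
    \<comment> \<open>A gap longer by one halves the term, and
      \<open>1 + gap_mantissa k g < 2\<close> makes the final inequality strict.\<close>
    have "(2::real) ^ (Suc (Suc (f k))) \<le> 2 ^ Suc (g k)"
      using assms True by (intro power_increasing) auto
    then have "(1 + gap_mantissa k g) / 2 ^ Suc (g k) \<le> (1 + gap_mantissa k g) / 2 ^ Suc (Suc (f k))"
      using gap_mantissa_bounds[of k g] by (intro divide_left_mono) auto
    also have "\<dots> < 1 / 2 ^ Suc (f k)"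
      using gap_mantissa_bounds[of k g] by (simp add: divide_simps)
    also have "\<dots> \<le> (1 + gap_mantissa k f) / 2 ^ Suc (f k)"
      using gap_mantissa_bounds[of k f] by (simp add: divide_simps)
    finally show ?thesis by simp
  qed
qed simp

section \<open>Numbers with prescribed binary gaps\<close>

definition gap_exponent :: "nat \<Rightarrow> (nat \<Rightarrow> nat) \<Rightarrow> nat" where
  "gap_exponent k f = (\<Sum>i<k. Suc (f i))"

text \<open>The \<open>k + 1\<close> binary ones stand at the partial sums of the gaps, starting
  from the lowest digit at position 0.\<close>

definition gap_number :: "nat \<Rightarrow> (nat \<Rightarrow> nat) \<Rightarrow> nat" where
  "gap_number k f = (\<Sum>j\<le>k. 2 ^ gap_exponent j f)"

lemma gap_number_eq: "real (gap_number k f) = 2 ^ gap_exponent k f * (1 + gap_mantissa k f)"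
proof (induction k)
  case (Suc k)
  have "real (gap_number (Suc k) f) = 2 ^ gap_exponent (Suc k) f + real (gap_number k f)"
    by (simp add: gap_number_def)
  then show ?case unfolding Suc by (simp add: gap_exponent_def power_add field_simps)
qed (simp add: gap_number_def gap_exponent_def)

lemma gap_number_pos: "1 \<le> gap_number k f"
proof -
  have "0 < gap_number k f" unfolding gap_number_def by (intro sum_pos) auto
  then show ?thesis by simp
qed

lemma gap_exponent_mono: "j \<le> k \<Longrightarrow> gap_exponent j f \<le> gap_exponent k f"
  unfolding gap_exponent_def by (intro sum_mono2) auto

text \<open>The binary method: first all powers of two up to the leading one, then the partial sums
  from the lowest digit upwards, one step per further digit.\<close>

lemma gap_number_chain:
  "addition_chain (\<lambda>i. if i \<le> gap_exponent k f then 2 ^ i else gap_number (i - gap_exponent k f) f)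
     (gap_exponent k f + k) (gap_number k f)"
proof -
  define K where "K = gap_exponent k f"
  define a where "a i = (if i \<le> K then 2 ^ i else gap_number (i - K) f)" for i
  have "a (K + k) = gap_number k f"
    by (cases k) (auto simp: a_def K_def gap_number_def gap_exponent_def)
  moreover have "\<exists>i<t. \<exists>j<t. a t = a i + a j" if t: "1 \<le> t" "t \<le> K + k" for t
  proof (cases "t \<le> K")
    case True
    then show ?thesis
      using t by (intro exI[of _ "t - 1"] conjI) (auto simp: a_def power_eq_if)
  next
    case False
    then obtain j where j: "t = K + Suc j" "j < k"
      using t by (metis add_Suc_right add_le_cancel_left less_imp_Suc_add not_le Suc_le_eq)
    have e: "gap_exponent (Suc j) f \<le> K" unfolding K_def using j by (intro gap_exponent_mono) auto
    have at: "a t = 2 ^ gap_exponent (Suc j) f + gap_number j f"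
      using j by (simp add: a_def gap_number_def)
    have "2 ^ gap_exponent (Suc j) f = a (gap_exponent (Suc j) f)" using e by (simp add: a_def)
    moreover have "\<exists>i<t. gap_number j f = a i"
    proof (cases j)
      \<comment> \<open>\<open>gap_number 0 f\<close> is 1 and is found at index 0; index
        \<open>K\<close> holds \<open>2 ^ K\<close> instead.\<close>
      case 0
      then show ?thesis
        using j by (intro exI[of _ 0]) (auto simp: a_def gap_number_def gap_exponent_def)
    next
      case (Suc j')
      then show ?thesis using j by (intro exI[of _ "K + j"]) (auto simp: a_def)
    qed
    moreover have "gap_exponent (Suc j) f < t" using e j by simp
    ultimately show ?thesis using at by metis
  qed
  ultimately have "addition_chain a (K + k) (gap_number k f)"
    unfolding addition_chain_def by (auto simp: a_def)
  then show ?thesis unfolding a_def K_def by simp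
qed

text \<open>The chain above gives \<open>s \<le> k\<close>, so a fixed \<open>k\<close> leaves only
  finitely many values of \<open>s\<close>; they serve as the colours below.\<close>

lemma gap_number_defect:
  obtains s where "s \<le> k" "chain_length (gap_number k f) = gap_exponent k f + s"
    "defect (gap_number k f) = real s - log 2 (1 + gap_mantissa k f)"
proof -
  let ?n = "gap_number k f" and ?K = "gap_exponent k f"
  have n: "2 ^ ?K \<le> real ?n"
    unfolding gap_number_eq using gap_mantissa_bounds[of k f] by simp
  from n le_two_power_chain_length[OF gap_number_pos[of k f]] have "(2::real) ^ ?K \<le> 2 ^ chain_length ?n"
    by linarith
  then have "?K \<le> chain_length ?n" by simp
  then obtain s where s: "chain_length ?n = ?K + s" using le_Suc_ex by auto
  moreover have "s \<le> k" using chain_length_le[OF gap_number_chain, of k f] s by simp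
  ultimately show ?thesis
    using that defect_eq[OF gap_number_eq s] gap_mantissa_bounds[of k f] by simp
qed

text \<open>The ordinal power \<open>\<omega> ^ k\<close> is indivisible: some colour class contains a copy of it.\<close>

lemma monochromatic_copy:
  fixes c :: "(nat \<Rightarrow> nat) \<Rightarrow> nat"
  assumes "\<And>f. f \<in> supported_below k \<Longrightarrow> c f \<le> N"
  shows "\<exists>h q. (\<forall>f\<in>supported_below k. h f \<in> supported_below k \<and> c (h f) = q) \<and>
           (\<forall>f\<in>supported_below k. \<forall>g\<in>supported_below k. lex_less f g \<longrightarrow> lex_less (h f) (h g))"
  using assms
proof (induction k arbitrary: c)
  case 0
  then show ?case
    by (intro exI[of _ id] exI[of _ "c (\<lambda>_. 0)"]) (auto simp: supported_below_def)
next
  case (Suc k)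
  have upd: "f(k := t) \<in> supported_below (Suc k)" if "f \<in> supported_below k" for f t
    using that by (auto simp: supported_below_def)
  define P where "P t h q \<longleftrightarrow>
     (\<forall>f\<in>supported_below k. h f \<in> supported_below k \<and> c ((h f)(k := t)) = q) \<and>
     (\<forall>f\<in>supported_below k. \<forall>g\<in>supported_below k. lex_less f g \<longrightarrow> lex_less (h f) (h g))"
    for t h q
  \<comment> \<open>Fixing the leading coefficient \<open>t\<close> leaves a slice of type
    \<open>\<omega> ^ k\<close>, in which the induction hypothesis gives a copy of a single colour
    \<open>q t\<close>.\<close>
  have "\<exists>h q. P t h q" for t
    unfolding P_def by (rule Suc.IH) (use Suc.prems upd in blast)
  then have "\<forall>t. \<exists>h q. P t h q" by blast
  then obtain h q where "\<And>t. P t (h t) (q t)" by metis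
  then have h: "\<And>t f. f \<in> supported_below k \<Longrightarrow> h t f \<in> supported_below k"
      "\<And>t f. f \<in> supported_below k \<Longrightarrow> c ((h t f)(k := t)) = q t"
      "\<And>t f g. f \<in> supported_below k \<Longrightarrow> g \<in> supported_below k \<Longrightarrow> lex_less f g
        \<Longrightarrow> lex_less (h t f) (h t g)"
    unfolding P_def by blast+
  have z: "(\<lambda>_. 0) \<in> supported_below k" by (simp add: supported_below_def)
  have "q t \<le> N" for t using Suc.prems[OF upd[OF h(1)[OF z]]] h(2)[OF z] by metis
  then have "range q \<subseteq> {..N}" by auto
  then have "finite (range q)" using finite_subset by blast
  \<comment> \<open>Infinitely many slices share a colour; \<open>e\<close> enumerates them
    increasingly, and \<open>H\<close> sends slice \<open>i\<close> into slice
    \<open>e i\<close>.\<close>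
  then obtain t0 where "infinite {t. q t = q t0}"
    using pigeonhole_infinite[of UNIV q] by auto
  from infinite_enumerate[OF this]
  obtain e :: "nat \<Rightarrow> nat" where e: "strict_mono e" "\<And>i. q (e i) = q t0" by blast
  define H where "H f = (h (e (f k)) (f(k := 0)))(k := e (f k))" for f
  have cut: "f(k := 0) \<in> supported_below k" if "f \<in> supported_below (Suc k)" for f
    using that by (auto simp: supported_below_def)
  have "H f \<in> supported_below (Suc k) \<and> c (H f) = q t0" if "f \<in> supported_below (Suc k)" for f
    unfolding H_def using upd[OF h(1)[OF cut[OF that]]] h(2)[OF cut[OF that]] e(2) by simp
  moreover have "lex_less (H f) (H g)"
    if fg: "f \<in> supported_below (Suc k)" "g \<in> supported_below (Suc k)" "lex_less f g" for f g
  proof -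
    have HS: "H f' i = 0" if "f' \<in> supported_below (Suc k)" "i > k" for f' i
      using h(1)[OF cut[OF that(1)]] that(2) by (auto simp: H_def supported_below_def)
    obtain m where m: "f m < g m" "\<forall>i>m. f i = g i" using fg by (auto simp: lex_less_def)
    have "m \<le> k" using supported_below_less[OF fg(2) m(1)] by simp
    show ?thesis
    proof (cases "m = k")
      case True
      then have "e (f k) < e (g k)" using e(1) m(1) by (simp add: strict_mono_less)
      then show ?thesis
        unfolding lex_less_def using HS fg by (intro exI[of _ k]) (auto simp: H_def)
    next
      case False
      then have k: "f k = g k" "m < k" using m(2) \<open>m \<le> k\<close> by auto
      then have "lex_less (f(k := 0)) (g(k := 0))"
        unfolding lex_less_def using m by (intro exI[of _ m]) auto
      then have "lex_less (h (e (f k)) (f(k := 0))) (h (e (f k)) (g(k := 0)))"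
        using h(3) cut fg by blast
      then obtain j where j: "h (e (f k)) (f(k := 0)) j < h (e (f k)) (g(k := 0)) j"
        "\<forall>i>j. h (e (f k)) (f(k := 0)) i = h (e (f k)) (g(k := 0)) i"
        unfolding lex_less_def by blast
      have "j < k" by (rule supported_below_less[OF h(1)[OF cut[OF fg(2)]] j(1)])
      then show ?thesis
        unfolding lex_less_def using j k by (intro exI[of _ j]) (auto simp: H_def)
    qed
  qed
  ultimately show ?case by (intro exI[of _ H] exI[of _ "q t0"]) blast
qed

text \<open>On a copy where \<open>c\<close> is constant the defect depends on the mantissa alone
  and increases as the mantissa decreases.\<close>

lemma embedding_into_defect_set:
  obtains F where "\<And>f. f \<in> supported_below k \<Longrightarrow> F f \<in> defect_set"
    "\<And>f g. f \<in> supported_below k \<Longrightarrow> g \<in> supported_below k \<Longrightarrow> lex_less f g \<Longrightarrow> F f < F g"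
proof -
  define c where "c f = chain_length (gap_number k f) - gap_exponent k f" for f
  have c: "c f \<le> k" "defect (gap_number k f) = real (c f) - log 2 (1 + gap_mantissa k f)" for f
  proof -
    obtain s where s: "s \<le> k" "chain_length (gap_number k f) = gap_exponent k f + s"
      "defect (gap_number k f) = real s - log 2 (1 + gap_mantissa k f)"
      using gap_number_defect .
    moreover have "c f = s" unfolding c_def s(2) by simp
    ultimately show "c f \<le> k" "defect (gap_number k f) = real (c f) - log 2 (1 + gap_mantissa k f)"
      by simp_all
  qed
  obtain h q where h: "\<And>f. f \<in> supported_below k \<Longrightarrow> h f \<in> supported_below k"
      "\<And>f. f \<in> supported_below k \<Longrightarrow> c (h f) = q"
      "\<And>f g. f \<in> supported_below k \<Longrightarrow> g \<in> supported_below k \<Longrightarrow> lex_less f g \<Longrightarrow> lex_less (h f) (h g)"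
    using monochromatic_copy[of k c k] c(1) by metis
  show ?thesis
  proof (rule that[of "\<lambda>f. defect (gap_number k (h f))"])
    fix f
    show "defect (gap_number k (h f)) \<in> defect_set"
      unfolding defect_set_def using gap_number_pos by blast
  next
    fix f g assume fg: "f \<in> supported_below k" "g \<in> supported_below k" "lex_less f g"
    then obtain m where m: "h f m < h g m" "\<forall>i>m. h f i = h g i"
      using h(3) unfolding lex_less_def by blast
    have "m < k" by (rule supported_below_less[OF h(1)[OF fg(2)] m(1)])
    then have "gap_mantissa k (h g) < gap_mantissa k (h f)"
      using gap_mantissa_antimono[OF m] by blast
    then show "defect (gap_number k (h f)) < defect (gap_number k (h g))"
      using c(2) h(2) fg gap_mantissa_bounds[of k "h g"] by simp
  qed
qed

section \<open>Comparison of order types\<close>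

text \<open>At a minimal \<open>z\<close> moved down by \<open>h\<close>, monotonicity moves the
  smaller point \<open>h z\<close> down as well, a contradiction.\<close>

lemma wf_no_regressive_map:
  assumes "wf R" "a \<in> S" "(h a, a) \<in> R" "\<And>x. x \<in> S \<Longrightarrow> h x \<in> S"
    "\<And>x y. x \<in> S \<Longrightarrow> y \<in> S \<Longrightarrow> (x, y) \<in> R \<Longrightarrow> (h x, h y) \<in> R"
  shows False
proof -
  define Q where "Q = {x \<in> S. (h x, x) \<in> R}"
  have "a \<in> Q" using assms(2,3) by (simp add: Q_def)
  then obtain z where "z \<in> Q" and min: "\<And>y. (y, z) \<in> R \<Longrightarrow> y \<notin> Q"
    using wfE_min[OF assms(1)] by metis
  then have z: "z \<in> S" "(h z, z) \<in> R" by (auto simp: Q_def)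
  have "(h (h z), h z) \<in> R" by (rule assms(5)[OF assms(4)[OF z(1)] z])
  then show False using min[OF z(2)] assms(4)[OF z(1)] by (simp add: Q_def)
qed

text \<open>\<open>r\<close> is isomorphic to a proper initial segment of \<open>r'\<close>, the
  points strictly below some \<open>a\<close>; strict monotonicity and the bound \<open>a\<close>
  are what is kept of this.\<close>

lemma ordLess_strict_embedding:
  assumes "(r, r') \<in> ordLess"
  obtains e a where "a \<in> Field r'" "\<And>x. x \<in> Field r \<Longrightarrow> (e x, a) \<in> r' - Id"
    "\<And>x y. (x, y) \<in> r - Id \<Longrightarrow> (e x, e y) \<in> r' - Id"
proof -
  have wo: "Well_order r" "Well_order r'" using assms by (auto simp: ordLess_def)
  obtain a where a: "a \<in> Field r'" "(r, Restr r' (underS r' a)) \<in> ordIso"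
    using assms ordLess_iff_ordIso_Restr[OF wo(2,1)] by blast
  obtain e where e: "iso r (Restr r' (underS r' a)) e" using a(2) by (auto simp: ordIso_def)
  have sub: "Field (Restr r' (underS r' a)) \<subseteq> underS r' a" by (auto simp: Field_def)
  have bij: "bij_betw e (Field r) (Field (Restr r' (underS r' a)))" using e by (simp add: iso_def)
  have inj: "inj_on e (Field r)" using bij by (simp add: bij_betw_def)
  have compat: "compat r (Restr r' (underS r' a)) e"
    using e wo embed_compat by (auto simp: iso_def)
  show ?thesis
  proof (rule that[OF a(1)])
    fix x assume "x \<in> Field r"
    then have "e x \<in> underS r' a" using bij sub by (auto simp: bij_betw_def)
    then show "(e x, a) \<in> r' - Id" by (auto simp: underS_def)
  next
    fix x y assume xy: "(x, y) \<in> r - Id"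
    then have "x \<in> Field r" "y \<in> Field r" by (auto simp: Field_def)
    then have "e x \<noteq> e y" using inj xy by (auto dest: inj_onD)
    then show "(e x, e y) \<in> r' - Id" using compat xy by (auto simp: compat_def)
  qed
qed

text \<open>\<open>ordLeq\<close> asks for an embedding as an initial segment, whereas
  \<open>h\<close> is just strictly monotone. If \<open>r'\<close> were shorter, composing
  \<open>h\<close> with a strict embedding of \<open>r'\<close> below some \<open>a\<close> would
  move \<open>a\<close> down.\<close>

lemma strict_mono_ordLeq:
  assumes "Well_order r" "Well_order r'" "\<And>x. x \<in> Field r \<Longrightarrow> h x \<in> Field r'"
    "\<And>x y. (x, y) \<in> r - Id \<Longrightarrow> (h x, h y) \<in> r' - Id"
  shows "(r, r') \<in> ordLeq"
proof (rule ccontr)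
  assume "(r, r') \<notin> ordLeq"
  then have "(r', r) \<in> ordLess" using assms by (simp add: not_ordLeq_iff_ordLess)
  then obtain e a where e: "a \<in> Field r" "\<And>x. x \<in> Field r' \<Longrightarrow> (e x, a) \<in> r - Id"
    "\<And>x y. (x, y) \<in> r' - Id \<Longrightarrow> (e x, e y) \<in> r - Id"
    using ordLess_strict_embedding by metis
  have wf: "wf (r - Id)" using assms(1) by (simp add: well_order_on_def)
  show False
  proof (rule wf_no_regressive_map[OF wf e(1), of "e \<circ> h"])
    show "((e \<circ> h) a, a) \<in> r - Id" using e assms(3) by simp
    fix x assume "x \<in> Field r"
    then have "(e (h x), a) \<in> r" using e(2) assms(3) by blast
    then show "(e \<circ> h) x \<in> Field r" by (simp add: FieldI1)
  next
    fix x y assume "(x, y) \<in> r - Id"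
    then show "((e \<circ> h) x, (e \<circ> h) y) \<in> r - Id"
      unfolding comp_apply by (intro e(3) assms(4))
  qed
qed

section \<open>The order type of the set of defects\<close>

theorem theorem1p3:
  shows "well_order_on defect_set (relation_of (\<le>) defect_set) \<and>
         (relation_of (\<le>) defect_set, omega_pow_omega) \<in> ordIso"
proof -
  let ?r = "relation_of (\<le>) defect_set"
  have Fr: "Field ?r = defect_set" by (auto simp: Field_def relation_of_def)
  have less: "(x, y) \<in> ?r - Id \<longleftrightarrow> x \<in> defect_set \<and> y \<in> defect_set \<and> x < y" for x y
    by (auto simp: relation_of_def)
  have code: "(defect_code x, defect_code y) \<in> omega_pow_omega - Id" if "(x, y) \<in> ?r - Id" for x y
    unfolding strict_omega_pow_omega_iff
    using that defect_code_Field defect_code_less unfolding less by blast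
  have "?r - Id \<subseteq> inv_image (omega_pow_omega - Id) defect_code"
    by (intro subrelI) (use code in \<open>simp only: in_inv_image\<close>)
  then have "wf (?r - Id)" by (rule wf_subset[OF wf_inv_image[OF wf_omega_pow_omega]])
  then have wo: "well_order_on defect_set ?r"
    unfolding well_order_on_def linear_order_on_def partial_order_on_def preorder_on_def
    by (intro conjI) (auto simp: relation_of_def refl_on_def trans_def antisym_def total_on_def)
  then have Wo: "Well_order ?r" by (simp add: Fr)
  have "(?r, omega_pow_omega) \<in> ordLeq"
    by (rule strict_mono_ordLeq[OF Wo Well_order_omega_pow_omega _ code])
      (unfold Fr, rule defect_code_Field)
  moreover have "(omega_pow_omega, ?r) \<in> ordLeq"
  proof (rule ccontr)
    assume "(omega_pow_omega, ?r) \<notin> ordLeq"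
    then have "(?r, omega_pow_omega) \<in> ordLess"
      using Wo Well_order_omega_pow_omega by (simp add: not_ordLeq_iff_ordLess)
    then obtain e a where a: "a \<in> Field omega_pow_omega"
      and e: "\<And>x. x \<in> Field ?r \<Longrightarrow> (e x, a) \<in> omega_pow_omega - Id"
        "\<And>x y. (x, y) \<in> ?r - Id \<Longrightarrow> (e x, e y) \<in> omega_pow_omega - Id"
      using ordLess_strict_embedding by metis
    \<comment> \<open>Finite support places \<open>a\<close> below \<open>\<omega> ^ k\<close>,
      which embeds into the defects by \<open>F\<close>; thus \<open>e \<circ> F\<close> maps
      \<open>supported_below k\<close> to itself and moves \<open>a\<close> down.\<close>
    obtain k where k: "a \<in> supported_below k"
      using a unfolding Field_omega_pow_omega mem_Collect_eq finite_support_iff by blast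
    obtain F where F: "\<And>f. f \<in> supported_below k \<Longrightarrow> F f \<in> defect_set"
      "\<And>f g. f \<in> supported_below k \<Longrightarrow> g \<in> supported_below k \<Longrightarrow> lex_less f g \<Longrightarrow> F f < F g"
      using embedding_into_defect_set[of k] by metis
    have below: "(e (F f), a) \<in> omega_pow_omega - Id" if "f \<in> supported_below k" for f
      by (rule e(1)) (unfold Fr, rule F(1)[OF that])
    show False
    proof (rule wf_no_regressive_map[OF wf_omega_pow_omega k, of "e \<circ> F"])
      show "((e \<circ> F) a, a) \<in> omega_pow_omega - Id"
        unfolding comp_apply by (rule below[OF k])
      fix f assume "f \<in> supported_below k"
      then show "(e \<circ> F) f \<in> supported_below k"
        using below[of f] supported_below_lex_less[OF _ _ k]
        unfolding strict_omega_pow_omega_iff comp_apply by blast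
    next
      fix f g assume "f \<in> supported_below k" "g \<in> supported_below k" "(f, g) \<in> omega_pow_omega - Id"
      then have "(F f, F g) \<in> ?r - Id"
        using F unfolding less strict_omega_pow_omega_iff by blast
      then show "((e \<circ> F) f, (e \<circ> F) g) \<in> omega_pow_omega - Id"
        unfolding comp_apply by (rule e(2))
    qed
  qed
  ultimately show ?thesis using wo by (simp add: ordIso_iff_ordLeq)
qed

end
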